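(* Every simultaneously uniformly convex and uniformly smooth Banach space $Y$ of dimension greater than $1$ is not a universal pointwise BPB range space.
   Context: Banach spaces are over $\mathbb{K}$, where $\mathbb{K}=\mathbb{R}$ or $\mathbb{K}=\mathbb{C}$. $\mathcal{L}(X,Y)$ is the Banach space of bounded linear operators from $X$ to $Y$; $B_X$, $S_X$ are the closed unit ball and unit sphere of $X$. A pair $(X,Y)$ of Banach spaces has the pointwise BPB property if for every $\varepsilon>0$ there is $\eta>0$ such that whenever $T\in\mathcal{L}(X,Y)$ with $\|T\|=1$ and $x_0\in S_X$ satisfy $\|T(x_0)\|>1-\eta$, there is $S\in\mathcal{L}(X,Y)$ with $\|S\|=1$, $\|S(x_0)\|=1$ and $\|S-T\|<\varepsilon$. A Banach space $Y$ is a universal pointwise BPB range space if $(X,Y)$ has the pointwise BPB property for every uniformly smooth Banach space $X$. Uniformly smooth: $\lim_{t\to0^+}\rho_X(t)/t=0$, where $\rho_X(t)=\sup\{\frac{\|x+y\|+\|x-y\|-2}{2}: \|x\|=1,\ \|y\|\leq t\}$ for $0<t\leq1$. Uniformly convex: $\delta_X(\varepsilon)=\inf\{1-\|\frac{x+y}{2}\|: x,y\in B_X,\ \|x-y\|\geq\varepsilon\}>0$ for all $\varepsilon\in(0,2]$. *)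

theory Defs
  imports "HOL-Analysis.Analysis" "HOL-Library.Function_Algebras"
begin

text \<open>
  The scalar field \<open>\<bbbK>\<close> is \<open>\<real>\<close> or \<open>\<complex>\<close>, up to an isometric field isomorphism.
\<close>

class real_or_complex = real_normed_field +
  assumes real_or_complex:
    "(\<exists>\<phi> :: real \<Rightarrow> 'a. bij \<phi> \<and> (\<forall>x y. \<phi> (x + y) = \<phi> x + \<phi> y) \<and>
        (\<forall>x y. \<phi> (x * y) = \<phi> x * \<phi> y) \<and> (\<forall>x. norm (\<phi> x) = norm x)) \<or>
     (\<exists>\<phi> :: complex \<Rightarrow> 'a. bij \<phi> \<and> (\<forall>x y. \<phi> (x + y) = \<phi> x + \<phi> y) \<and>
        (\<forall>x y. \<phi> (x * y) = \<phi> x * \<phi> y) \<and> (\<forall>x. norm (\<phi> x) = norm x))"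

instance real :: real_or_complex
  by standard (rule disjI1, rule exI[of _ "\<lambda>x. x"], auto intro: bijI')

instance complex :: real_or_complex
  by standard (rule disjI2, rule exI[of _ "\<lambda>x. x"], auto intro: bijI')

text \<open>
  The domain space of the pointwise BPB property is quantified inside a formula, so it cannot be a
  type of class \<open>banach\<close>. A space is therefore a linear subspace \<open>carr\<close> of a vector space whose
  addition is that of the type \<open>'a\<close>, with its own scalar multiplication and its own norm; the
  values of \<open>nrm\<close> outside \<open>carr\<close> are irrelevant.
\<close>

record ('k, 'a) nspace =
  smul :: "'k \<Rightarrow> 'a \<Rightarrow> 'a"
  carr :: "'a set"
  nrm :: "'a \<Rightarrow> real"

definition banach_space :: "('k::real_or_complex, 'a::ab_group_add) nspace \<Rightarrow> bool" where
  "banach_space X \<longleftrightarrow>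
     vector_space (smul X) \<and>
     module.subspace (smul X) (carr X) \<and>
     (\<forall>x\<in>carr X. 0 \<le> nrm X x) \<and>
     (\<forall>x\<in>carr X. nrm X x = 0 \<longleftrightarrow> x = 0) \<and>
     (\<forall>x\<in>carr X. \<forall>c. nrm X (smul X c x) = norm c * nrm X x) \<and>
     (\<forall>x\<in>carr X. \<forall>y\<in>carr X. nrm X (x + y) \<le> nrm X x + nrm X y) \<and>
     (\<forall>u :: nat \<Rightarrow> 'a. (\<forall>n. u n \<in> carr X) \<longrightarrow>
        (\<forall>e>0. \<exists>M. \<forall>m\<ge>M. \<forall>n\<ge>M. nrm X (u m - u n) < e) \<longrightarrow>
        (\<exists>l\<in>carr X. (\<lambda>n. nrm X (u n - l)) \<longlonglongrightarrow> 0))"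

text \<open>
  A type of class \<open>banach\<close> with a scalar multiplication by \<open>\<bbbK>\<close>. If the result is a
  \<open>banach_space\<close>, then \<open>scaleK (of_real r) = scaleR r\<close> automatically, since both sides
  are additive and continuous in \<open>r\<close> and agree at \<open>r = 1\<close>.
\<close>

definition type_space :: "('k \<Rightarrow> 'a \<Rightarrow> 'a) \<Rightarrow> ('k, 'a::banach) nspace" where
  "type_space scaleK = \<lparr>smul = scaleK, carr = UNIV, nrm = norm\<rparr>"

text \<open>
  The constant \<open>dim\<close> of the library is 0 on infinite-dimensional spaces, hence the explicit basis.
\<close>

definition dim_greater_one :: "('k::real_or_complex, 'a::ab_group_add) nspace \<Rightarrow> bool" where
  "dim_greater_one X \<longleftrightarrow>
     (\<exists>B. \<not> module.dependent (smul X) B \<and> module.span (smul X) B = carr X \<and>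
          (infinite B \<or> 1 < card B))"

definition smoothness_modulus :: "('k, 'a::ab_group_add) nspace \<Rightarrow> real \<Rightarrow> real" where
  "smoothness_modulus X t =
     Sup {(nrm X (x + y) + nrm X (x - y) - 2) / 2 | x y.
            x \<in> carr X \<and> y \<in> carr X \<and> nrm X x = 1 \<and> nrm X y \<le> t}"

definition uniformly_smooth :: "('k, 'a::ab_group_add) nspace \<Rightarrow> bool" where
  "uniformly_smooth X \<longleftrightarrow> ((\<lambda>t. smoothness_modulus X t / t) \<longlongrightarrow> 0) (at_right 0)"

definition convexity_modulus ::
    "('k::real_or_complex, 'a::ab_group_add) nspace \<Rightarrow> real \<Rightarrow> real" where
  "convexity_modulus X \<epsilon> =
     Inf {1 - nrm X (smul X (1 / 2) (x + y)) | x y.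
            x \<in> carr X \<and> y \<in> carr X \<and> nrm X x \<le> 1 \<and> nrm X y \<le> 1 \<and> \<epsilon> \<le> nrm X (x - y)}"

definition uniformly_convex :: "('k::real_or_complex, 'a::ab_group_add) nspace \<Rightarrow> bool" where
  "uniformly_convex X \<longleftrightarrow> (\<forall>\<epsilon>. 0 < \<epsilon> \<and> \<epsilon> \<le> 2 \<longrightarrow> 0 < convexity_modulus X \<epsilon>)"

text \<open>Operators are total functions; only their values on \<open>carr X\<close> matter.\<close>

definition bounded_operators ::
    "('k, 'a::ab_group_add) nspace \<Rightarrow> ('k, 'b::ab_group_add) nspace \<Rightarrow> ('a \<Rightarrow> 'b) set" where
  "bounded_operators X Y =
     {T. (\<forall>x\<in>carr X. T x \<in> carr Y) \<and>
         (\<forall>x\<in>carr X. \<forall>y\<in>carr X. T (x + y) = T x + T y) \<and>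
         (\<forall>c. \<forall>x\<in>carr X. T (smul X c x) = smul Y c (T x)) \<and>
         (\<exists>C. \<forall>x\<in>carr X. nrm Y (T x) \<le> C * nrm X x)}"

definition operator_norm ::
    "('k, 'a::ab_group_add) nspace \<Rightarrow> ('k, 'b::ab_group_add) nspace \<Rightarrow> ('a \<Rightarrow> 'b) \<Rightarrow> real" where
  "operator_norm X Y T = Sup {nrm Y (T x) | x. x \<in> carr X \<and> nrm X x \<le> 1}"

definition pointwise_BPB ::
    "('k, 'a::ab_group_add) nspace \<Rightarrow> ('k, 'b::ab_group_add) nspace \<Rightarrow> bool" where
  "pointwise_BPB X Y \<longleftrightarrow>
     (\<forall>\<epsilon>>0. \<exists>\<eta>>0. \<forall>T\<in>bounded_operators X Y. \<forall>x0\<in>carr X.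
        operator_norm X Y T = 1 \<and> nrm X x0 = 1 \<and> nrm Y (T x0) > 1 - \<eta> \<longrightarrow>
        (\<exists>S\<in>bounded_operators X Y.
           operator_norm X Y S = 1 \<and> nrm Y (S x0) = 1 \<and>
           operator_norm X Y (\<lambda>x. S x - T x) < \<epsilon>))"

text \<open>
  A formula cannot quantify over all types, so the domains range over the Banach spaces carried by
  a given type \<open>'x\<close>. A smaller \<open>'x\<close> makes the negation of this property stronger: to fail it is
  to exhibit a uniformly smooth Banach space inside \<open>'x\<close> whose pair with \<open>Y\<close> is not pointwise BPB.
\<close>

definition universal_pointwise_BPB_range ::
    "'x::ab_group_add itself \<Rightarrow> ('k::real_or_complex, 'y::ab_group_add) nspace \<Rightarrow> bool" where
  "universal_pointwise_BPB_range _ Y \<longleftrightarrow>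
     (\<forall>X :: ('k, 'x) nspace.
        banach_space X \<and> uniformly_smooth X \<longrightarrow> pointwise_BPB X Y)"

end

theory Submission
  imports Defs
begin

text \<open>
  The domain is \<open>Y\<close> itself with an equivalent norm \<open>N\<close> dominating the original one, and the operator
  is the formal identity. The norm \<open>N\<close> is uniformly smooth, but its unit sphere contains points
  \<open>x\<^sub>k\<close> at which it is flat in a direction \<open>v\<^sub>k\<close>, with \<open>norm x\<^sub>k\<close> tending to 1. Since \<open>Y\<close> is strictly
  convex, an operator \<open>S\<close> of norm 1 attaining its norm at \<open>x\<^sub>k\<close> must kill \<open>v\<^sub>k\<close>, hence stays away from
  the identity.

  To obtain \<open>N\<close>, choose unit vectors \<open>y\<^sub>k\<close> with norming functionals \<open>f\<^sub>k\<close> such that, by uniform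
  convexity, \<open>norm (f\<^sub>j y\<^sub>k)\<close> is bounded away from 1 for fixed \<open>j\<close> as well as for fixed \<open>k\<close>. With
  \<open>\<alpha>\<^sub>k < 1\<close> tending to 1 fast enough, the norm \<open>max (norm y) (sup\<^sub>k norm (f\<^sub>k y) / \<alpha>\<^sub>k)\<close> is flat at \<open>y\<^sub>k\<close>
  along the kernel of \<open>f\<^sub>k\<close>, and its quadratic inf-convolution with the norm of \<open>Y\<close> is in addition
  uniformly smooth.
\<close>

section \<open>Real linearity and support functionals of a smooth real norm\<close>

text \<open>Additivity alone gives integer homogeneity. Splitting \<open>real n * r\<close> into
  floor and fractional part bounds \<open>n\<close> times the defect at \<open>r\<close>
  independently of \<open>n\<close>, so the defect vanishes.\<close>

lemma additive_bounded_imp_linear: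
  fixes h :: "'a::real_normed_vector \<Rightarrow> 'b::real_normed_vector"
  assumes add: "\<And>x y. h (x + y) = h x + h y"
    and bound: "\<And>x. norm (h x) \<le> C * norm x"
  shows "linear h"
proof (rule linearI)
  show "h (x + y) = h x + h y" for x y by (rule add)
  fix r :: real and x :: 'a
  have h0: "h 0 = 0" using add[of 0 0] by simp
  have hneg: "h (- y) = - h y" for y using add[of y "- y"] h0 by (simp add: eq_neg_iff_add_eq_0 add.commute)
  have hnat: "h (real n *\<^sub>R y) = real n *\<^sub>R h y" for n y
    by (induction n) (simp_all add: h0 add scaleR_left_distrib)
  have hint: "h (of_int m *\<^sub>R y) = of_int m *\<^sub>R h y" for m y
    by (cases m rule: int_cases2) (simp_all add: hnat hneg)
  have C0: "0 \<le> C * norm x" using bound[of x] norm_ge_zero order_trans by blast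
  define D where "D = h (r *\<^sub>R x) - r *\<^sub>R h x"
  have "real n * norm D \<le> 2 * (C * norm x)" for n
  proof -
    define s where "s = frac (real n * r)"
    have s: "0 \<le> s" "s \<le> 1" using frac_lt_1[of "real n * r"] by (auto simp: s_def)
    have nr: "real n * r = of_int \<lfloor>real n * r\<rfloor> + s" by (simp add: s_def frac_def)
    have "real n *\<^sub>R h (r *\<^sub>R x) = h ((real n * r) *\<^sub>R x)"
      using hnat[of n "r *\<^sub>R x"] by simp
    also have "\<dots> = of_int \<lfloor>real n * r\<rfloor> *\<^sub>R h x + h (s *\<^sub>R x)"
      by (subst nr) (simp only: scaleR_left_distrib add hint)
    also have "\<dots> = (real n * r) *\<^sub>R h x + (h (s *\<^sub>R x) - s *\<^sub>R h x)"
      by (subst (2) nr) (simp add: scaleR_left_distrib)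
    finally have "real n *\<^sub>R D = h (s *\<^sub>R x) - s *\<^sub>R h x"
      by (simp add: D_def scaleR_right_diff_distrib)
    hence "real n * norm D = norm (h (s *\<^sub>R x) - s *\<^sub>R h x)"
      by (metis norm_scaleR abs_of_nat)
    also have "\<dots> \<le> norm (h (s *\<^sub>R x)) + s * norm (h x)"
      using norm_triangle_ineq4[of "h (s *\<^sub>R x)" "s *\<^sub>R h x"] s by simp
    also have "\<dots> \<le> s * (C * norm x) + s * (C * norm x)"
      using bound[of "s *\<^sub>R x"] mult_left_mono[OF bound[of x] s(1)] s by (simp add: ac_simps)
    also have "\<dots> \<le> 2 * (C * norm x)"
      using mult_right_mono[OF s(2) C0] by linarith
    finally show ?thesis .
  qed
  hence "norm D \<le> 0"
    by (meson ex_less_of_nat_mult not_le)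
  thus "h (r *\<^sub>R x) = r *\<^sub>R h x" by (simp add: D_def)
qed

text \<open>Uniform smoothness with the supremum unfolded and the bound made proportional to
  \<open>N y\<close>. The function \<open>N\<close> is arbitrary, so that norms other than that of
  the type are covered.\<close>

definition smooth_norm :: "('a::ab_group_add \<Rightarrow> real) \<Rightarrow> bool" where
  "smooth_norm N \<longleftrightarrow>
     (\<forall>e>0. \<exists>d>0. \<forall>x y. N x = 1 \<longrightarrow> N y \<le> d \<longrightarrow> N (x + y) + N (x - y) - 2 \<le> e * N y)"

text \<open>The functional is the Gateaux derivative of the norm, so no Hahn--Banach theorem is needed.\<close>

lemma real_support_functional:
  fixes x :: "'a::real_normed_vector"
  assumes x: "norm x = 1" and smooth: "smooth_norm (norm :: 'a \<Rightarrow> real)"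
  obtains g :: "'a \<Rightarrow> real" where "linear g" "\<And>y. g y \<le> norm y" "g x = 1"
proof -
  \<comment> \<open>Difference quotients of the norm at \<open>x\<close>. Convexity makes them
    monotone in \<open>t\<close>, so their infimum is the one-sided derivative.\<close>
  define q where "q t y = (norm (x + t *\<^sub>R y) - 1) / t" for t y
  define g where "g y = (INF t\<in>{0<..}. q t y)" for y
  have q_lower: "- norm y \<le> q t y" if "t > 0" for t y
  proof -
    have "norm x \<le> norm (x + t *\<^sub>R y) + norm (t *\<^sub>R y)"
      by (metis add_diff_cancel_right' norm_triangle_ineq4)
    thus ?thesis using that x by (simp add: q_def field_simps)
  qed
  have q_upper: "q t y \<le> norm y" if "t > 0" for t y
    using that x norm_triangle_ineq[of x "t *\<^sub>R y"] by (simp add: q_def field_simps)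
  have q_mono: "q s y \<le> q t y" if "0 < s" "s \<le> t" for s t y
  proof -
    have "x + s *\<^sub>R y = (1 - s / t) *\<^sub>R x + (s / t) *\<^sub>R (x + t *\<^sub>R y)"
      using that by (simp add: algebra_simps)
    hence "norm (x + s *\<^sub>R y) \<le> \<bar>1 - s / t\<bar> * norm x + \<bar>s / t\<bar> * norm (x + t *\<^sub>R y)"
      by (metis norm_scaleR norm_triangle_ineq)
    also have "\<dots> = (1 - s / t) + (s / t) * norm (x + t *\<^sub>R y)"
      using that x by simp
    finally have "norm (x + s *\<^sub>R y) - 1 \<le> (s / t) * (norm (x + t *\<^sub>R y) - 1)"
      by (simp add: right_diff_distrib)
    thus ?thesis using that by (simp add: q_def field_simps)
  qed
  have bdd: "bdd_below ((\<lambda>t. q t y) ` {0<..})" for y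
    by (rule bdd_belowI[of _ "- norm y"]) (auto intro: q_lower)
  have g_le: "g y \<le> q t y" if "t > 0" for t y
    unfolding g_def using that by (intro cINF_lower[OF bdd]) auto
  have g_ge: "c \<le> g y" if "\<And>t. t > 0 \<Longrightarrow> c \<le> q t y" for c y
    unfolding g_def using that by (intro cINF_greatest) (auto intro: exI[of _ 1])
  have g_approx: "\<exists>t>0. q t y < g y + e" if "e > 0" for e y
    using g_ge[of "g y + e" y] that by (meson add_le_same_cancel1 leD not_le)
  have g_norm: "g y \<le> norm y" for y
    using g_le[of 1 y] q_upper[of 1 y] by simp
  have g_sub: "g (y + z) \<le> g y + g z" for y z
  proof (rule field_le_epsilon)
    fix e :: real assume "e > 0"
    then obtain s t where s: "s > 0" "q s y < g y + e / 2" and t: "t > 0" "q t z < g z + e / 2"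
      using g_approx[of "e / 2"] by (meson half_gt_zero)
    \<comment> \<open>Monotonicity moves both quotients to the common parameter \<open>m\<close>; a
      midpoint then combines them into the quotient of \<open>y + z\<close> at
      \<open>m / 2\<close>.\<close>
    define m where "m = min s t"
    have m: "m > 0" "m \<le> s" "m \<le> t" using s t by (auto simp: m_def)
    have "2 *\<^sub>R (x + (m / 2) *\<^sub>R (y + z)) = (x + m *\<^sub>R y) + (x + m *\<^sub>R z)"
      by (simp add: algebra_simps scaleR_2)
    hence "2 * norm (x + (m / 2) *\<^sub>R (y + z)) \<le> norm (x + m *\<^sub>R y) + norm (x + m *\<^sub>R z)"
      by (metis abs_numeral norm_scaleR norm_triangle_ineq)
    hence "(2 * norm (x + (m / 2) *\<^sub>R (y + z)) - 2) / m
        \<le> (norm (x + m *\<^sub>R y) + norm (x + m *\<^sub>R z) - 2) / m"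
      using m by (intro divide_right_mono) auto
    moreover have "(2 * norm (x + (m / 2) *\<^sub>R (y + z)) - 2) / m = q (m / 2) (y + z)"
      using m by (simp add: q_def diff_divide_distrib)
    moreover have "(norm (x + m *\<^sub>R y) + norm (x + m *\<^sub>R z) - 2) / m = q m y + q m z"
      by (simp add: q_def add_divide_distrib diff_divide_distrib)
    ultimately have "q (m / 2) (y + z) \<le> q m y + q m z" by simp
    moreover have "g (y + z) \<le> q (m / 2) (y + z)" using m by (intro g_le) simp
    ultimately show "g (y + z) \<le> g y + g z + e"
      using q_mono[OF m(1,2), of y] q_mono[OF m(1,3), of z] s t by linarith
  qed
  \<comment> \<open>This is where smoothness enters: \<open>q t y + q t (- y)\<close> is a second
    difference of the norm divided by \<open>t\<close>, hence small. Oddness turns the subadditivity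
    of \<open>g\<close> into additivity.\<close>
  have g_odd: "g y + g (- y) = 0" for y
  proof (rule antisym)
    have small: "g y + g (- y) \<le> 0 + e * norm y" if e: "e > 0" for e
    proof -
      obtain d where d: "d > 0"
        "\<And>y. norm y \<le> d \<Longrightarrow> norm (x + y) + norm (x - y) - 2 \<le> e * norm y"
        using smooth e x unfolding smooth_norm_def by blast
      \<comment> \<open>The summand 1 keeps the denominator positive when
        \<open>y = 0\<close>.\<close>
      define t where "t = d / (norm y + 1)"
      have ny: "0 < norm y + 1" using norm_ge_zero[of y] by linarith
      have t: "t > 0" using d ny by (simp add: t_def)
      have "norm y * d \<le> (norm y + 1) * d" using d by (intro mult_right_mono) auto
      hence "norm (t *\<^sub>R y) \<le> d" using d ny by (simp add: t_def field_simps)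
      hence "norm (x + t *\<^sub>R y) + norm (x - t *\<^sub>R y) - 2 \<le> e * (t * norm y)"
        using d(2)[of "t *\<^sub>R y"] t by simp
      hence "(norm (x + t *\<^sub>R y) + norm (x - t *\<^sub>R y) - 2) / t \<le> e * norm y"
        using t by (simp add: pos_divide_le_eq ac_simps)
      moreover have "(norm (x + t *\<^sub>R y) + norm (x - t *\<^sub>R y) - 2) / t = q t y + q t (- y)"
        by (simp add: q_def add_divide_distrib diff_divide_distrib)
      ultimately have "q t y + q t (- y) \<le> e * norm y" by simp
      thus ?thesis using g_le[OF t, of y] g_le[OF t, of "- y"] by linarith
    qed
    have "g y + g (- y) \<le> 0 + e" if "e > 0" for e
      using that small[OF that] small[of "e / norm y"] by (cases "y = 0") simp_all
    thus "g y + g (- y) \<le> 0" by (rule field_le_epsilon)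
    have "0 \<le> g 0" by (rule g_ge) (simp add: q_def x)
    thus "0 \<le> g y + g (- y)" using g_sub[of y "- y"] by simp
  qed
  have g_add: "g (y + z) = g y + g z" for y z
    using g_sub[of y z] g_sub[of "- y" "- z"] g_odd[of y] g_odd[of z] g_odd[of "y + z"]
    by (simp add: algebra_simps)
  have "linear g"
  proof (rule additive_bounded_imp_linear[where C = 1])
    show "norm (g y) \<le> 1 * norm y" for y
      using g_norm[of y] g_norm[of "- y"] g_odd[of y] by auto
  qed (rule g_add)
  moreover have "g x = 1"
  proof (rule antisym)
    show "1 \<le> g x"
    proof (rule g_ge)
      fix t :: real assume "t > 0"
      moreover have "x + t *\<^sub>R x = (1 + t) *\<^sub>R x" by (simp add: algebra_simps)
      ultimately show "1 \<le> q t x" by (simp add: q_def x)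
    qed
  qed (use g_norm[of x] x in simp)
  ultimately show ?thesis using g_norm that by blast
qed

section \<open>Support functionals over the scalar field and separated sequences\<close>

locale normed_space_over = vector_space scaleK
  for scaleK :: "'k::real_or_complex \<Rightarrow> 'y::real_normed_vector \<Rightarrow> 'y" +
  assumes norm_scale: "norm (scaleK c x) = norm c * norm x"
begin

lemma scale_of_real: "scaleK (of_real r) x = r *\<^sub>R x"
proof -
  have "linear (\<lambda>r. scaleK (of_real r) x)"
    by (rule additive_bounded_imp_linear[where C = "norm x"])
       (simp_all add: scale_left_distrib norm_scale)
  from linear_scale[OF this, of r 1] show ?thesis by simp
qed

text \<open>These are the elements of the closed unit ball of the dual space.\<close>

definition functional :: "('y \<Rightarrow> 'k) \<Rightarrow> bool" where
  "functional f \<longleftrightarrow>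
     (\<forall>y z. f (y + z) = f y + f z) \<and> (\<forall>c y. f (scaleK c y) = c * f y) \<and> (\<forall>y. norm (f y) \<le> norm y)"

lemma functionalD:
  assumes "functional f"
  shows "f (y + z) = f y + f z" "f (scaleK c y) = c * f y" "norm (f y) \<le> norm y"
    "f (y - z) = f y - f z" "f 0 = 0" "f (r *\<^sub>R y) = of_real r * f y"
proof -
  show *: "f (y + z) = f y + f z" "f (scaleK c y) = c * f y" "norm (f y) \<le> norm y" for y z c
    using assms by (auto simp: functional_def)
  show "f (y - z) = f y - f z" using *(1)[of "y - z" z] by simp
  show "f 0 = 0" using *(2)[of 0 0] by simp
  show "f (r *\<^sub>R y) = of_real r * f y" using *(2)[of "of_real r" y] by (simp add: scale_of_real)
qed

text \<open>Over the reals the real support functional \<open>g\<close> itself serves. Over the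
  complex numbers the functional with real part \<open>g\<close> is \<open>g y - i g (i y)\<close>,
  transported to the scalars by \<open>\<phi>\<close>.\<close>

lemma exists_support_functional:
  assumes x: "norm x = 1" and smooth: "smooth_norm (norm :: 'y \<Rightarrow> real)"
  shows "\<exists>f. functional f \<and> f x = 1"
proof -
  obtain g where g: "linear g" "\<And>y. g y \<le> norm y" "g x = 1"
    using real_support_functional[OF x smooth] by blast
  note glin = linear_add[OF g(1)] linear_scale[OF g(1)] linear_neg[OF g(1)]
  from real_or_complex[where 'a = 'k] show ?thesis
  proof (elim disjE exE conjE)
    fix \<phi> :: "real \<Rightarrow> 'k"
    assume \<phi>: "bij \<phi>" "\<forall>x y. \<phi> (x + y) = \<phi> x + \<phi> y" "\<forall>x y. \<phi> (x * y) = \<phi> x * \<phi> y"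
      "\<forall>x. norm (\<phi> x) = norm x"
    have lin: "linear \<phi>"
      by (rule additive_bounded_imp_linear[where C = 1]) (simp_all add: \<phi>)
    have "\<phi> 1 * \<phi> 1 = \<phi> 1" "\<phi> 1 \<noteq> 0" using \<phi>(3,4) by (metis mult_1, metis norm_one norm_zero zero_neq_one)
    hence one: "\<phi> 1 = 1" by simp
    have \<phi>r: "\<phi> r = of_real r" for r
      using linear_scale[OF lin, of r 1] one by (simp add: of_real_def)
    have "functional (\<lambda>y. of_real (g y))"
      unfolding functional_def
    proof (intro conjI allI)
      fix c :: 'k and y
      obtain r where r: "c = of_real r" using surjD[OF bij_is_surj[OF \<phi>(1)], of c] \<phi>r by auto
      show "of_real (g (scaleK c y)) = c * of_real (g y)"
        by (simp add: r scale_of_real glin)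
    next
      fix y show "norm (of_real (g y) :: 'k) \<le> norm y"
        using g(2)[of y] g(2)[of "- y"] by (simp add: glin)
    qed (simp add: glin)
    thus ?thesis using g(3) by auto
  next
    fix \<phi> :: "complex \<Rightarrow> 'k"
    assume \<phi>: "bij \<phi>" "\<forall>x y. \<phi> (x + y) = \<phi> x + \<phi> y" "\<forall>x y. \<phi> (x * y) = \<phi> x * \<phi> y"
      "\<forall>x. norm (\<phi> x) = norm x"
    have lin: "linear \<phi>"
      by (rule additive_bounded_imp_linear[where C = 1]) (simp_all add: \<phi>)
    have "\<phi> 1 * \<phi> 1 = \<phi> 1" "\<phi> 1 \<noteq> 0" using \<phi>(3,4) by (metis mult_1, metis norm_one norm_zero zero_neq_one)
    hence one: "\<phi> 1 = 1" by simp
    have \<phi>r: "\<phi> (of_real r) = of_real r" for r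
      using linear_scale[OF lin, of r 1] one by (simp add: of_real_def)
    define J where "J = \<phi> \<i>"
    have \<phi>C: "\<phi> (Complex a b) = of_real a + of_real b * J" for a b
      using \<phi>(2,3) \<phi>r by (metis J_def complex_eq mult.commute complex.sel)
    have JJ: "J * J = - 1"
      using \<phi>(3) linear_neg[OF lin, of 1] one by (metis J_def complex_i_mult_minus i_squared)
    define f where "f y = \<phi> (Complex (g y) (- g (scaleK J y)))" for y
    have f_add: "f (y + z) = f y + f z" for y z
    proof -
      have "Complex (g (y + z)) (- g (scaleK J (y + z))) =
          Complex (g y) (- g (scaleK J y)) + Complex (g z) (- g (scaleK J z))"
        by (simp add: glin scale_right_distrib complex_eq_iff)
      thus ?thesis unfolding f_def using \<phi>(2) by presburger
    qed
    have f_scale: "f (scaleK c y) = c * f y" for c y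
    proof -
      obtain a b where c: "c = \<phi> (Complex a b)" using surjD[OF bij_is_surj[OF \<phi>(1)], of c] by (metis complex.exhaust)
      have 1: "scaleK c y = a *\<^sub>R y + b *\<^sub>R scaleK J y"
        by (simp add: c \<phi>C scale_left_distrib flip: scale_of_real scale_scale)
      have "scaleK J (scaleK c y) = a *\<^sub>R scaleK J y - b *\<^sub>R y"
      proof -
        have "scaleK J (scaleK c y) = scaleK (of_real a * J + of_real b * (J * J)) y"
          by (simp add: c \<phi>C algebra_simps)
        thus ?thesis unfolding JJ by (simp add: scale_left_diff_distrib scale_of_real flip: scale_scale)
      qed
      hence "Complex (g (scaleK c y)) (- g (scaleK J (scaleK c y))) =
          Complex a b * Complex (g y) (- g (scaleK J y))"
        by (simp add: 1 glin linear_diff[OF g(1)] complex_eq_iff)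
      thus ?thesis unfolding f_def c using \<phi>(3) by presburger
    qed
    have f_norm: "norm (f y) \<le> norm y" for y
    proof (cases "f y = 0")
      case False
      \<comment> \<open>Rotation making the value of \<open>f\<close> real and nonnegative, so that
        it equals the value of \<open>g\<close>, which the norm bounds.\<close>
      define \<theta> where "\<theta> = of_real (norm (f y)) / f y"
      have "f (scaleK \<theta> y) = \<phi> (of_real (norm (f y)))"
        using False by (simp add: f_scale \<theta>_def \<phi>r)
      hence "Complex (g (scaleK \<theta> y)) (- g (scaleK J (scaleK \<theta> y))) = of_real (norm (f y))"
        unfolding f_def[of "scaleK \<theta> y"] by (rule injD[OF bij_is_inj[OF \<phi>(1)]])
      hence "g (scaleK \<theta> y) = norm (f y)" by (simp add: complex_eq_iff)
      moreover have "norm \<theta> = 1" using False by (simp add: \<theta>_def norm_divide)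
      ultimately show ?thesis using g(2)[of "scaleK \<theta> y"] by (simp add: norm_scale)
    qed simp
    \<comment> \<open>The real part of \<open>f x\<close> is 1 and its modulus is at most 1, so the
      imaginary part is 0.\<close>
    have "cmod (Complex 1 (- g (scaleK J x))) \<le> 1"
      using f_norm[of x] \<phi>(4) g(3) x by (simp add: f_def)
    hence "g (scaleK J x) = 0" by (simp add: cmod_def)
    hence "f x = 1" unfolding f_def g(3) using \<phi>C[of 1 0] by simp
    thus ?thesis using f_add f_scale f_norm unfolding functional_def by blast
  qed
qed

text \<open>A vector \<open>w\<close> off the line of \<open>y\<close>, minus its component
  \<open>f w\<close> along \<open>y\<close>, is a nonzero element of the kernel.\<close>

lemma kernel_vector:
  assumes f: "functional f" and y: "f y = 1" and dim: "\<And>y. \<exists>w. \<forall>c. w \<noteq> scaleK c y"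
  shows "\<exists>v. norm v = 1 \<and> f v = 0"
proof -
  obtain w where w: "w \<noteq> scaleK c y" for c using dim[of y] by blast
  define z where "z = w - scaleK (f w) y"
  have z: "z \<noteq> 0" "f z = 0" using w[of "f w"] y by (simp_all add: z_def functionalD[OF f])
  show ?thesis
    by (rule exI[of _ "(1 / norm z) *\<^sub>R z"]) (use z in \<open>simp add: functionalD[OF f]\<close>)
qed

text \<open>
  The points are the normalised vectors \<open>u + 2\<^sup>-\<^sup>j v\<close>; each of them has positive distance from
  the unimodular multiples of all the others.
\<close>

lemma exists_separated_unit_vectors:
  assumes f: "functional f" and u: "norm u = 1" "f u = 1" and v: "norm v = 1" "f v = 0"
  shows "\<exists>y d. \<forall>j. norm (y j) = 1 \<and> 0 < d j \<and>
    (\<forall>k \<theta>. k \<noteq> j \<longrightarrow> norm \<theta> = 1 \<longrightarrow> d j \<le> norm (y j - scaleK \<theta> (y (k::nat))))"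
proof (intro exI allI)
  fix j :: nat
  define s :: "nat \<Rightarrow> real" where "s j = (1 / 2) ^ j" for j
  define e where "e j = u + s j *\<^sub>R v" for j
  define y where "y j = (1 / norm (e j)) *\<^sub>R e j" for j
  \<comment> \<open>With \<open>D\<close> the distance to be bounded,
    \<open>s j / 4 \<le> l j * \<bar>s j - s k\<bar> \<le> 3 * D\<close>, whence the 12.\<close>
  define d where "d j = s j / 12" for j
  have s: "0 < s j" "s j \<le> 1" for j by (auto simp: s_def power_le_one)
  have gap: "s j / 2 \<le> \<bar>s j - s k\<bar>" if "k \<noteq> j" for j k
  proof (cases "k < j")
    case True
    have "s (Suc k) \<ge> s j" unfolding s_def using True by (intro power_decreasing) auto
    hence "2 * s j \<le> s k" by (simp add: s_def)
    thus ?thesis using s(1)[of j] by linarith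
  next
    case False
    hence "s k \<le> s (Suc j)" unfolding s_def using that by (intro power_decreasing) auto
    hence "2 * s k \<le> s j" by (simp add: s_def)
    thus ?thesis by linarith
  qed
  have fe: "f (e j) = 1" for j by (simp add: e_def functionalD[OF f] u v)
  have e_norm: "1 \<le> norm (e j)" "norm (e j) \<le> 2" for j
    using functionalD(3)[OF f, of "e j"] fe[of j] norm_triangle_ineq[of u "s j *\<^sub>R v"] s[of j] u v
    by (auto simp: e_def)
  show "norm (y j) = 1 \<and> 0 < d j \<and>
    (\<forall>k \<theta>. k \<noteq> j \<longrightarrow> norm \<theta> = 1 \<longrightarrow> d j \<le> norm (y j - scaleK \<theta> (y (k::nat))))"
  proof (intro conjI allI impI)
    have "e j \<noteq> 0" using e_norm(1)[of j] by auto
    thus "norm (y j) = 1" by (simp add: y_def)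
    show "0 < d j" using s by (simp add: d_def)
    fix k and \<theta> :: 'k assume k: "k \<noteq> j" and \<theta>: "norm \<theta> = 1"
    define l where "l j = 1 / norm (e j)" for j
    define D where "D = norm (y j - scaleK \<theta> (y k))"
    \<comment> \<open>\<open>A\<close> and \<open>B\<close> are the coordinates of the difference
      along \<open>u\<close> and \<open>v\<close>.\<close>
    define A where "A = of_real (l j) - \<theta> * of_real (l k)"
    define B where "B = of_real (l j * s j) - \<theta> * of_real (l k * s k)"
    have yl: "y j = scaleK (of_real (l j)) u + scaleK (of_real (l j * s j)) v" for j
      unfolding scale_of_real by (simp add: y_def l_def e_def scaleR_right_distrib)
    have w: "y j - scaleK \<theta> (y k) = scaleK A u + scaleK B v"
      by (simp add: yl[of j] yl[of k] A_def B_def scale_right_distrib scale_left_diff_distrib)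
    have "f (y j - scaleK \<theta> (y k)) = A" unfolding w by (simp add: functionalD[OF f] u v)
    hence A: "norm A \<le> D" using functionalD(3)[OF f, of "y j - scaleK \<theta> (y k)"] by (simp add: D_def)
    have "norm (scaleK B v) \<le> norm (y j - scaleK \<theta> (y k)) + norm (scaleK A u)"
      unfolding w by (metis add_diff_cancel_left' norm_triangle_ineq4)
    hence B: "norm B \<le> 2 * D" using A u v by (simp add: norm_scale D_def)
    \<comment> \<open>Subtracting \<open>s k\<close> times \<open>A\<close> from \<open>B\<close>
      cancels the terms with \<open>\<theta>\<close>.\<close>
    have "of_real (l j * (s j - s k)) = B - of_real (s k) * A"
      by (simp add: A_def B_def algebra_simps)
    hence "\<bar>l j * (s j - s k)\<bar> \<le> norm B + s k * norm A"
      by (metis norm_of_real norm_mult norm_triangle_ineq4 abs_of_pos s(1))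
    moreover have "s k * norm A \<le> 1 * norm A" using s by (intro mult_right_mono) auto
    moreover have "1 / 2 \<le> l j"
      unfolding l_def using e_norm[of j] by (intro frac_le) linarith+
    hence "(1 / 2) * \<bar>s j - s k\<bar> \<le> l j * \<bar>s j - s k\<bar>"
      by (rule mult_right_mono) simp
    moreover have "0 \<le> l j" by (simp add: l_def)
    ultimately show "d j \<le> norm (y j - scaleK \<theta> (y k))"
      using gap[OF k] A B unfolding D_def d_def by (simp add: abs_mult)
  qed
qed

text \<open>If \<open>norm (f j (y k))\<close> were close to 1, then \<open>y j\<close> plus a
  suitable unimodular multiple of \<open>y k\<close> would have norm close to 2, against uniform
  convexity and the separation of the two vectors. The separations \<open>d j\<close> and
  \<open>d k\<close> give the two bounds.\<close>

lemma exists_separated_functionals: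
  assumes smooth: "smooth_norm (norm :: 'y \<Rightarrow> real)"
    and convex: "\<And>d. 0 < d \<Longrightarrow> \<exists>c>0. \<forall>x y::'y.
      norm x \<le> 1 \<longrightarrow> norm y \<le> 1 \<longrightarrow> d \<le> norm (x - y) \<longrightarrow> norm (x + y) \<le> 2 - c"
    and dim: "\<And>y. \<exists>w. \<forall>c. w \<noteq> scaleK c y"
  shows "\<exists>y f \<gamma>. \<forall>j::nat. norm (y j) = 1 \<and> functional (f j) \<and> f j (y j) = 1 \<and> 0 < \<gamma> j \<and>
    (\<forall>k. k \<noteq> j \<longrightarrow> norm (f j (y k)) \<le> 1 - \<gamma> j \<and> norm (f j (y k)) \<le> 1 - \<gamma> k)"
proof -
  obtain w :: 'y where w: "w \<noteq> 0" using dim[of 0] by auto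
  define u where "u = (1 / norm w) *\<^sub>R w"
  have u: "norm u = 1" using w by (simp add: u_def)
  obtain g where g: "functional g" "g u = 1" using exists_support_functional[OF u smooth] by blast
  obtain v where v: "norm v = 1" "g v = 0" using kernel_vector[OF g dim] by blast
  obtain y d where y: "\<And>j. norm (y j) = 1" and d: "\<And>j. 0 < d j"
    and sep: "\<And>j k \<theta>. k \<noteq> (j::nat) \<Longrightarrow> norm \<theta> = 1 \<Longrightarrow> d j \<le> norm (y j - scaleK \<theta> (y k))"
    using exists_separated_unit_vectors[OF g(1) u g(2) v] by blast
  obtain f where f: "\<And>j. functional (f j)" "\<And>j. f j (y j) = 1"
    using exists_support_functional[OF y smooth] by metis
  obtain \<gamma> where \<gamma>: "\<And>j. 0 < \<gamma> j" "\<And>j x z. norm x \<le> 1 \<Longrightarrow> norm z \<le> 1 \<Longrightarrow>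
      d j \<le> norm (x - z) \<Longrightarrow> norm (x + z :: 'y) \<le> 2 - \<gamma> j"
    using convex[OF d] by metis
  have "norm (f j (y k)) \<le> 1 - \<gamma> j \<and> norm (f j (y k)) \<le> 1 - \<gamma> k" if "k \<noteq> j" for j k
  proof -
    define a where "a = f j (y k)"
    \<comment> \<open>Rotates \<open>a\<close> onto \<open>norm a\<close>; the value 1 at
      \<open>a = 0\<close> keeps \<open>\<theta>\<close> unimodular.\<close>
    define \<theta> where "\<theta> = (if a = 0 then 1 else of_real (norm a) / a)"
    have \<theta>: "norm \<theta> = 1" by (simp add: \<theta>_def norm_divide)
    have "f j (y j + scaleK \<theta> (y k)) = of_real (1 + norm a)"
      by (simp add: functionalD[OF f(1)] f(2) \<theta>_def flip: a_def)
    hence "1 + norm a \<le> norm (y j + scaleK \<theta> (y k))"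
      using functionalD(3)[OF f(1), of j "y j + scaleK \<theta> (y k)"] by (simp del: of_real_add)
    moreover have "norm (y j + scaleK \<theta> (y k)) \<le> 2 - \<gamma> j"
      using sep[OF that \<theta>] by (intro \<gamma>(2)) (simp_all add: y norm_scale \<theta>)
    moreover have "norm (y j + scaleK \<theta> (y k)) \<le> 2 - \<gamma> k"
    proof (intro \<gamma>(2))
      \<comment> \<open>Multiplication by the inverse of \<open>\<theta>\<close> exchanges the roles
        of \<open>j\<close> and \<open>k\<close>, which makes \<open>d k\<close> available.\<close>
      have "\<theta> \<noteq> 0" using \<theta> by auto
      hence "scaleK \<theta> (y k - scaleK (inverse \<theta>) (y j)) = scaleK \<theta> (y k) - y j"
        by (simp add: scale_right_diff_distrib)
      hence "norm (y k - scaleK (inverse \<theta>) (y j)) = norm (y j - scaleK \<theta> (y k))"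
        by (metis \<theta> mult_1 norm_minus_commute norm_scale)
      thus "d k \<le> norm (y j - scaleK \<theta> (y k))"
        using sep[of j k "inverse \<theta>"] that \<theta> by (simp add: norm_inverse)
    qed (simp_all add: y norm_scale \<theta>)
    ultimately show ?thesis by (simp add: a_def)
  qed
  thus ?thesis using y f \<gamma>(1) by blast
qed

end

section \<open>The smooth envelope of a gauge\<close>

text \<open>With \<open>p\<close>, \<open>q\<close>, \<open>m\<close> the norms of
  \<open>z + h\<close>, \<open>z - h\<close>, \<open>z\<close>, the left side is a sum of
  \<open>(p - m)\<^sup>2\<close>, \<open>(q - m)\<^sup>2\<close> and twice
  \<open>m * (p + q - 2 * m)\<close>. The squares are of second order in \<open>h\<close>; the last
  term is controlled by smoothness after scaling \<open>z\<close> to norm 1, or else by the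
  smallness of \<open>m\<close>.\<close>

lemma smooth_norm_square:
  assumes smooth: "smooth_norm (norm :: 'a::real_normed_vector \<Rightarrow> real)" and e: "0 < e"
  obtains d where "0 < d" "\<And>z h :: 'a. norm z \<le> 1 \<Longrightarrow> norm h \<le> d \<Longrightarrow>
    (norm (z + h))\<^sup>2 + (norm (z - h))\<^sup>2 - 2 * (norm z)\<^sup>2 \<le> e * norm h"
proof -
  obtain d where d: "0 < d" "\<And>x y :: 'a. norm x = 1 \<Longrightarrow> norm y \<le> d \<Longrightarrow>
      norm (x + y) + norm (x - y) - 2 \<le> (e / 4) * norm y"
    using smooth e unfolding smooth_norm_def by (metis divide_pos_pos zero_less_numeral)
  \<comment> \<open>The bound \<open>e / 4\<close> makes each square at most
    \<open>e / 4 * norm h\<close>; the bound \<open>e * d / 8\<close> forces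
    \<open>norm z \<le> e / 8\<close> whenever \<open>d * norm z \<le> norm h\<close>.\<close>
  define r where "r = min (e / 4) (e * d / 8)"
  show thesis
  proof (rule that)
    show "0 < r" using d e by (simp add: r_def)
    fix z h :: 'a assume z: "norm z \<le> 1" and h: "norm h \<le> r"
    define p q m n where "p = norm (z + h)" and "q = norm (z - h)" and "m = norm z" and "n = norm h"
    have n: "0 \<le> n" "n \<le> e / 4" "n \<le> e * d / 8" using h by (auto simp: n_def r_def)
    have m: "0 \<le> m" "m \<le> 1" using z by (auto simp: m_def)
    have "\<bar>p - m\<bar> \<le> n" "\<bar>q - m\<bar> \<le> n"
      using norm_triangle_ineq3[of "z + h" z] norm_triangle_ineq3[of "z - h" z]
      by (simp_all add: p_def q_def m_def n_def)
    hence pq: "(p - m)\<^sup>2 \<le> n\<^sup>2" "(q - m)\<^sup>2 \<le> n\<^sup>2" "p + q - 2 * m \<le> 2 * n"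
      by (auto simp: abs_le_square_iff[symmetric])
    have nn: "n\<^sup>2 \<le> e / 4 * n" using mult_right_mono[OF n(2,1)] by (simp add: power2_eq_square)
    have "m * (p + q - 2 * m) \<le> e / 4 * n"
    proof (cases "n \<le> d * m \<and> m \<noteq> 0")
      case True
      hence m0: "0 < m" using m by auto
      have "norm ((1 / m) *\<^sub>R z + (1 / m) *\<^sub>R h) + norm ((1 / m) *\<^sub>R z - (1 / m) *\<^sub>R h) - 2
          \<le> (e / 4) * norm ((1 / m) *\<^sub>R h)"
        using True m0 by (intro d) (auto simp: m_def n_def field_simps)
      hence "p / m + q / m - 2 \<le> e / 4 * (n / m)"
        using m0 unfolding scaleR_right_distrib[symmetric] scaleR_right_diff_distrib[symmetric]
        by (simp add: p_def q_def n_def)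
      hence "(p + q - 2 * m) / m \<le> (e / 4 * n) / m"
        using m0 by (simp add: add_divide_distrib diff_divide_distrib)
      hence *: "p + q - 2 * m \<le> e / 4 * n" using m0 divide_le_cancel[of _ m] by (metis less_asym)
      have "m * (p + q - 2 * m) \<le> m * (e / 4 * n)" using * m by (intro mult_left_mono)
      also have "\<dots> \<le> 1 * (e / 4 * n)" using m n e by (intro mult_right_mono) auto
      finally show ?thesis by simp
    next
      case False
      hence "d * m \<le> n" using n m by auto
      hence "d * m \<le> e * d / 8" using n by linarith
      hence "m \<le> e / 8" using d by (simp add: field_simps)
      hence "m * (2 * n) \<le> e / 8 * (2 * n)" using n by (intro mult_right_mono) auto
      moreover have "m * (p + q - 2 * m) \<le> m * (2 * n)" using pq m by (intro mult_left_mono)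
      ultimately show ?thesis by simp
    qed
    moreover have "p\<^sup>2 + q\<^sup>2 - 2 * m\<^sup>2 = (p - m)\<^sup>2 + (q - m)\<^sup>2 + 2 * (m * (p + q - 2 * m))"
      by (simp add: power2_eq_square algebra_simps)
    ultimately have "p\<^sup>2 + q\<^sup>2 - 2 * m\<^sup>2 \<le> e * n" using pq nn by simp
    thus "(norm (z + h))\<^sup>2 + (norm (z - h))\<^sup>2 - 2 * (norm z)\<^sup>2 \<le> e * norm h"
      by (simp add: p_def q_def m_def n_def)
  qed
qed

text \<open>
  \<open>envelope y\<close> is the square root of the Moreau envelope of the squared gauge whose epigraph is \<open>Q\<close>.
  Since \<open>a\<close> can be kept while \<open>y\<close> varies, it is as smooth as the norm, however rough the gauge is.
\<close>

locale gauge_epigraph = normed_space_over scaleK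
  for scaleK :: "'k::real_or_complex \<Rightarrow> 'y::real_normed_vector \<Rightarrow> 'y" +
  fixes Q :: "'y \<Rightarrow> real \<Rightarrow> bool"
  assumes Q_zero: "Q 0 0"
    and Q_add: "Q a l \<Longrightarrow> Q b m \<Longrightarrow> Q (a + b) (l + m)"
    and Q_scale: "Q a l \<Longrightarrow> Q (scaleK c a) (norm c * l)"
    and Q_norm: "Q a l \<Longrightarrow> norm a \<le> l"
begin

definition envelope :: "'y \<Rightarrow> real" where
  "envelope y = Inf {sqrt (2 * l\<^sup>2 + 2 * (norm (y - a))\<^sup>2) | a l. Q a l}"

lemma envelope_le: "Q a l \<Longrightarrow> envelope y \<le> sqrt (2 * l\<^sup>2 + 2 * (norm (y - a))\<^sup>2)"
  unfolding envelope_def by (rule cInf_lower) (auto intro!: bdd_belowI[of _ 0])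

lemma envelope_ge:
  "(\<And>a l. Q a l \<Longrightarrow> c \<le> sqrt (2 * l\<^sup>2 + 2 * (norm (y - a))\<^sup>2)) \<Longrightarrow> c \<le> envelope y"
  unfolding envelope_def using Q_zero by (intro cInf_greatest) auto

lemma envelope_approx:
  assumes "envelope y < c"
  obtains a l where "Q a l" "sqrt (2 * l\<^sup>2 + 2 * (norm (y - a))\<^sup>2) < c"
  using envelope_ge[of c y] assms by (meson not_le)

lemma envelope_square_le: "Q a l \<Longrightarrow> (envelope y)\<^sup>2 \<le> 2 * l\<^sup>2 + 2 * (norm (y - a))\<^sup>2"
  using power_mono[OF envelope_le[of a l y] envelope_ge[of 0 y], of 2] by simp

text \<open>The factors 2 in the envelope serve this bound, through the inequality between
  \<open>(p + q)\<^sup>2\<close> and \<open>2 * p\<^sup>2 + 2 * q\<^sup>2\<close>.\<close>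

lemma norm_le_envelope: "norm y \<le> envelope y"
proof (rule envelope_ge)
  fix a l assume "Q a l"
  hence "norm y \<le> l + norm (y - a)"
    using Q_norm norm_triangle_sub[of y a] by fastforce
  hence "(norm y)\<^sup>2 \<le> (l + norm (y - a))\<^sup>2" by (intro power_mono) auto
  also have "\<dots> \<le> 2 * l\<^sup>2 + 2 * (norm (y - a))\<^sup>2"
    using sum_squares_bound[of l "norm (y - a)"] by (simp add: power2_sum)
  finally show "norm y \<le> sqrt (2 * l\<^sup>2 + 2 * (norm (y - a))\<^sup>2)" by (rule real_le_rsqrt)
qed

lemma envelope_le_norm: "envelope y \<le> 2 * norm y"
proof -
  have "envelope y \<le> sqrt (2 * (norm y)\<^sup>2)" using envelope_le[OF Q_zero, of y] by simp
  also have "\<dots> \<le> 2 * norm y" by (rule real_le_lsqrt) (auto simp: power_mult_distrib)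
  finally show ?thesis .
qed

text \<open>Near-minimisers for \<open>y\<close> and \<open>z\<close> add up to a competitor for
  \<open>y + z\<close>; the triangle inequality of the Euclidean plane does the rest.\<close>

lemma envelope_add: "envelope (y + z) \<le> envelope y + envelope z"
proof (rule field_le_epsilon)
  fix e :: real assume "0 < e"
  obtain a l where a: "Q a l" "sqrt (2 * l\<^sup>2 + 2 * (norm (y - a))\<^sup>2) < envelope y + e / 2"
    using envelope_approx[of y "envelope y + e / 2"] \<open>0 < e\<close> by auto
  obtain b m where b: "Q b m" "sqrt (2 * m\<^sup>2 + 2 * (norm (z - b))\<^sup>2) < envelope z + e / 2"
    using envelope_approx[of z "envelope z + e / 2"] \<open>0 < e\<close> by auto
  have sq: "sqrt (2 * x\<^sup>2 + 2 * w\<^sup>2) = sqrt 2 * sqrt (x\<^sup>2 + w\<^sup>2)" for x w :: real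
    by (simp only: distrib_left flip: real_sqrt_mult)
  have "norm (y + z - (a + b)) \<le> norm (y - a) + norm (z - b)"
    by (metis add_diff_add norm_triangle_ineq)
  hence "(norm (y + z - (a + b)))\<^sup>2 \<le> (norm (y - a) + norm (z - b))\<^sup>2"
    by (intro power_mono) auto
  hence "envelope (y + z) \<le> sqrt (2 * (l + m)\<^sup>2 + 2 * (norm (y - a) + norm (z - b))\<^sup>2)"
    by (intro order_trans[OF envelope_le[OF Q_add[OF a(1) b(1)], of "y + z"]]) simp
  also have "\<dots> \<le> sqrt (2 * l\<^sup>2 + 2 * (norm (y - a))\<^sup>2) + sqrt (2 * m\<^sup>2 + 2 * (norm (z - b))\<^sup>2)"
    unfolding sq using mult_left_mono[OF real_sqrt_sum_squares_triangle_ineq, of "sqrt 2"]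
    by (simp add: distrib_left)
  finally show "envelope (y + z) \<le> envelope y + envelope z + e" using a(2) b(2) by linarith
qed

text \<open>For nonzero \<open>c\<close>, scaling competitors gives one inequality, and the same
  with \<open>inverse c\<close> gives the other. At \<open>c = 0\<close> the bounds by the norm
  force the value 0.\<close>

lemma envelope_scale: "envelope (scaleK c y) = norm c * envelope y"
proof -
  have le: "envelope (scaleK c y) \<le> norm c * envelope y" if c: "c \<noteq> 0" for c y
  proof -
    have "envelope (scaleK c y) / norm c \<le> envelope y"
    proof (rule envelope_ge)
      fix a l assume "Q a l"
      from envelope_le[OF Q_scale[OF this, of c], of "scaleK c y"]
      have "envelope (scaleK c y) \<le> sqrt (2 * (norm c * l)\<^sup>2 + 2 * (norm c * norm (y - a))\<^sup>2)"
        by (simp add: norm_scale flip: scale_right_diff_distrib)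
      also have "\<dots> = sqrt ((norm c)\<^sup>2 * (2 * l\<^sup>2 + 2 * (norm (y - a))\<^sup>2))"
        by (simp add: power_mult_distrib algebra_simps)
      also have "\<dots> = norm c * sqrt (2 * l\<^sup>2 + 2 * (norm (y - a))\<^sup>2)"
        by (simp add: real_sqrt_mult)
      finally show "envelope (scaleK c y) / norm c \<le> sqrt (2 * l\<^sup>2 + 2 * (norm (y - a))\<^sup>2)"
        using c by (simp add: field_simps)
    qed
    thus ?thesis using c by (simp add: field_simps)
  qed
  show ?thesis
  proof (cases "c = 0")
    case True
    thus ?thesis using envelope_le_norm[of 0] norm_le_envelope[of 0] by simp
  next
    case False
    hence "envelope y \<le> envelope (scaleK c y) / norm c"
      using le[of "inverse c" "scaleK c y"] by (simp add: norm_inverse divide_inverse mult.commute)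
    hence "norm c * envelope y \<le> envelope (scaleK c y)"
      using False by (simp add: pos_le_divide_eq mult.commute)
    thus ?thesis using le[OF False, of y] by linarith
  qed
qed

text \<open>A near-minimiser \<open>a\<close> for \<open>x\<close> competes also at
  \<open>x + h\<close> and \<open>x - h\<close>, which reduces the claim to the second difference of
  the squared norm at \<open>x - a\<close>.\<close>

lemma smooth_envelope:
  assumes smooth: "smooth_norm (norm :: 'y \<Rightarrow> real)"
  shows "smooth_norm envelope"
  unfolding smooth_norm_def
proof (intro allI impI)
  fix e :: real assume e: "0 < e"
  obtain d where d: "0 < d" "\<And>z h :: 'y. norm z \<le> 1 \<Longrightarrow> norm h \<le> d \<Longrightarrow>
      (norm (z + h))\<^sup>2 + (norm (z - h))\<^sup>2 - 2 * (norm z)\<^sup>2 \<le> e * norm h"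
    using smooth_norm_square[OF smooth e] by blast
  show "\<exists>d>0. \<forall>x y. envelope x = 1 \<longrightarrow> envelope y \<le> d \<longrightarrow>
      envelope (x + y) + envelope (x - y) - 2 \<le> e * envelope y"
  proof (intro exI[of _ d] conjI d(1) allI impI)
    fix x h assume x: "envelope x = 1" and h: "envelope h \<le> d"
    have "envelope (x + h) + envelope (x - h) - 2 \<le> e * norm h"
    proof (rule field_le_epsilon)
      fix \<kappa> :: real assume \<kappa>: "0 < \<kappa>"
      \<comment> \<open>The cap 1 yields \<open>norm (x - a) \<le> 1\<close>, which the estimate for
        squares requires.\<close>
      define \<mu> where "\<mu> = min 1 \<kappa>"
      have \<mu>: "0 < \<mu>" "\<mu> \<le> 1" "\<mu> \<le> \<kappa>" using \<kappa> by (auto simp: \<mu>_def)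
      have "envelope x < sqrt (1 + \<mu>)" using x \<mu> by simp
      then obtain a l where a: "Q a l" "2 * l\<^sup>2 + 2 * (norm (x - a))\<^sup>2 < 1 + \<mu>"
        by (elim envelope_approx) simp
      have "(norm (x - a))\<^sup>2 \<le> 1\<^sup>2" using a(2) \<mu>(2) zero_le_power2[of l] unfolding one_power2 by linarith
      hence z: "norm (x - a) \<le> 1" by (rule power2_le_imp_le) simp
      \<comment> \<open>The tangent of the square at 1, the value of the envelope at
        \<open>x\<close>, leads back from squares to the envelope.\<close>
      have sq: "2 * t \<le> 1 + t\<^sup>2" for t :: real
        using zero_le_power2[of "t - 1"] by (simp add: power2_diff)
      have "(norm (x - a + h))\<^sup>2 + (norm (x - a - h))\<^sup>2 - 2 * (norm (x - a))\<^sup>2 \<le> e * norm h"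
        using z norm_le_envelope[of h] h by (intro d(2)) auto
      moreover have "x + h - a = x - a + h" "x - h - a = x - a - h" by (auto simp: algebra_simps)
      ultimately show "envelope (x + h) + envelope (x - h) - 2 \<le> e * norm h + \<kappa>"
        using envelope_square_le[OF a(1), of "x + h"] envelope_square_le[OF a(1), of "x - h"]
          sq[of "envelope (x + h)"] sq[of "envelope (x - h)"] a(2) \<mu>(3) by (simp only:)
    qed
    also have "\<dots> \<le> e * envelope h" using e norm_le_envelope[of h] by simp
    finally show "envelope (x + h) + envelope (x - h) - 2 \<le> e * envelope h" .
  qed
qed

text \<open>
  If \<open>f\<close> is at most \<open>\<alpha>\<close> times the gauge, then the infimum at \<open>y\<close> is attained at \<open>a = (\<alpha>\<^sup>2 / (1 + \<alpha>\<^sup>2)) y\<close>.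
  The segment around this \<open>a\<close> on which the gauge is constant makes the envelope flat at \<open>y\<close>.
\<close>

lemma envelope_flat:
  assumes f: "functional f" "f y = 1" "norm y = 1" and \<alpha>: "0 < \<alpha>" "\<alpha> \<le> 1"
    and Qf: "\<And>a l. Q a l \<Longrightarrow> norm (f a) \<le> \<alpha> * l"
    and flat: "\<And>t. \<bar>t\<bar> \<le> \<tau> \<Longrightarrow> Q (y + t *\<^sub>R v) (1 / \<alpha>)" and \<tau>: "0 < \<tau>"
  shows "\<alpha> * envelope y \<le> 1" "\<exists>t>0. envelope (y + t *\<^sub>R v) \<le> envelope y \<and> envelope (y - t *\<^sub>R v) \<le> envelope y"
proof -
  \<comment> \<open>\<open>m\<close> is going to be the value of the envelope at \<open>y\<close>,
    and \<open>s\<close> the coefficient of the minimiser \<open>s *\<^sub>R y\<close>.\<close>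
  define m where "m = sqrt (2 / (1 + \<alpha>\<^sup>2))"
  define s where "s = \<alpha>\<^sup>2 / (1 + \<alpha>\<^sup>2)"
  have pos: "0 < 1 + \<alpha>\<^sup>2" by (simp add: add_pos_nonneg)
  have s: "0 < s" "1 - s = 1 / (1 + \<alpha>\<^sup>2)" using pos \<alpha> by (auto simp: s_def field_simps)
  \<comment> \<open>The flat segment scaled by \<open>s\<close> provides competitors whose
    difference from \<open>y + t *\<^sub>R v\<close> does not depend on \<open>t\<close>.\<close>
  have upper: "envelope (y + t *\<^sub>R v) \<le> m" if t: "\<bar>t\<bar> \<le> s * \<tau>" for t
  proof -
    have "Q (y + (t / s) *\<^sub>R v) (1 / \<alpha>)" using t s by (intro flat) (simp add: field_simps)
    from Q_scale[OF this, of "of_real s"] s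
    have "Q (s *\<^sub>R y + t *\<^sub>R v) (s / \<alpha>)"
      unfolding scale_of_real by (simp add: scaleR_right_distrib)
    from envelope_le[OF this, of "y + t *\<^sub>R v"]
    have "envelope (y + t *\<^sub>R v) \<le> sqrt (2 * (s / \<alpha>)\<^sup>2 + 2 * (norm (y - s *\<^sub>R y))\<^sup>2)" by simp
    also have "y - s *\<^sub>R y = (1 - s) *\<^sub>R y" by (simp add: algebra_simps)
    also have "2 * (s / \<alpha>)\<^sup>2 + 2 * (norm ((1 - s) *\<^sub>R y))\<^sup>2
        = 2 * (1 + \<alpha>\<^sup>2) / (1 + \<alpha>\<^sup>2)\<^sup>2"
      using \<alpha> pos f(3) unfolding s(2)
      by (simp add: s_def power2_eq_square flip: add_divide_distrib)
    also have "\<dots> = 2 / (1 + \<alpha>\<^sup>2)"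
      using pos by (simp only: power2_eq_square[of "1 + _"]) (simp del: distrib_left_numeral)
    finally show ?thesis by (simp add: m_def)
  qed
  have lower: "m \<le> envelope y"
  proof (rule envelope_ge)
    fix a l assume "Q a l"
    define u where "u = norm (f a)"
    have "u \<le> \<alpha> * l" using Qf[OF \<open>Q a l\<close>] by (simp add: u_def)
    moreover have "1 \<le> u + norm (y - a)"
      using functionalD(3)[OF f(1), of "y - a"] norm_triangle_ineq2[of 1 "f a"]
      by (simp add: functionalD(4)[OF f(1)] f(2) u_def)
    ultimately have "1 \<le> \<alpha> * l + norm (y - a)" by linarith
    hence "1\<^sup>2 \<le> (\<alpha> * l + norm (y - a))\<^sup>2" by (intro power_mono) auto
    \<comment> \<open>The added square completes the two-square identity, so this is the
      Cauchy-Schwarz inequality in the plane.\<close>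
    also have "\<dots> \<le> (\<alpha> * l + norm (y - a))\<^sup>2 + (l - \<alpha> * norm (y - a))\<^sup>2" by simp
    also have "\<dots> = (1 + \<alpha>\<^sup>2) * (l\<^sup>2 + (norm (y - a))\<^sup>2)"
      by (simp add: power2_eq_square algebra_simps)
    finally have "2 / (1 + \<alpha>\<^sup>2) \<le> 2 * l\<^sup>2 + 2 * (norm (y - a))\<^sup>2"
      using pos by (simp add: field_simps)
    thus "m \<le> sqrt (2 * l\<^sup>2 + 2 * (norm (y - a))\<^sup>2)" by (simp add: m_def)
  qed
  have "0 \<le> s * \<tau>" using s \<tau> by simp
  show "\<alpha> * envelope y \<le> 1"
  proof -
    have "\<alpha> * m \<le> 1"
    proof (rule power2_le_imp_le)
      have "\<alpha>\<^sup>2 \<le> 1" using \<alpha> by (simp add: power_le_one)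
      thus "(\<alpha> * m)\<^sup>2 \<le> 1\<^sup>2" using pos by (simp add: m_def power_mult_distrib field_simps)
    qed simp
    moreover have "\<alpha> * envelope y \<le> \<alpha> * m"
      using upper[of 0] \<open>0 \<le> s * \<tau>\<close> \<alpha> by simp
    ultimately show ?thesis by linarith
  qed
  have "envelope (y + (s * \<tau>) *\<^sub>R v) \<le> envelope y" "envelope (y - (s * \<tau>) *\<^sub>R v) \<le> envelope y"
    using upper[of "s * \<tau>"] upper[of "- (s * \<tau>)"] lower \<open>0 \<le> s * \<tau>\<close> by auto
  thus "\<exists>t>0. envelope (y + t *\<^sub>R v) \<le> envelope y \<and> envelope (y - t *\<^sub>R v) \<le> envelope y"
    using s \<tau> by (intro exI[of _ "s * \<tau>"]) auto
qed

end

section \<open>The renormed domain and its operators\<close>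

text \<open>A copy of the range space inside \<open>nat \<Rightarrow> 'y\<close>, on the sequences
  supported at index 0. Scalars act on every coordinate because \<open>banach_space\<close> asks for
  a vector space on the whole type.\<close>

definition renormed :: "('k \<Rightarrow> 'y \<Rightarrow> 'y) \<Rightarrow> ('y \<Rightarrow> real) \<Rightarrow> ('k, nat \<Rightarrow> 'y::ab_group_add) nspace" where
  "renormed scaleK N =
     \<lparr>smul = \<lambda>c u n. scaleK c (u n), carr = {u. \<forall>n. n \<noteq> 0 \<longrightarrow> u n = 0}, nrm = \<lambda>u. N (u 0)\<rparr>"

lemma renormed_simps [simp]:
  "smul (renormed scaleK N) c u = (\<lambda>n. scaleK c (u n))"
  "u \<in> carr (renormed scaleK N) \<longleftrightarrow> (\<forall>n. n \<noteq> 0 \<longrightarrow> u n = 0)"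
  "nrm (renormed scaleK N) u = N (u 0)"
  by (simp_all add: renormed_def)

definition head_seq :: "'y \<Rightarrow> nat \<Rightarrow> 'y::zero" where
  "head_seq y n = (if n = 0 then y else 0)"

locale equivalent_norm = normed_space_over scaleK
  for scaleK :: "'k::real_or_complex \<Rightarrow> 'y::banach \<Rightarrow> 'y" +
  fixes N :: "'y \<Rightarrow> real"
  assumes N_add: "N (y + z) \<le> N y + N z"
    and N_scale: "N (scaleK c y) = norm c * N y"
    and norm_le_N: "norm y \<le> N y"
    and N_le_norm: "N y \<le> 2 * norm y"
begin

abbreviation "X \<equiv> renormed scaleK N"

lemma head_seq_in_carr [simp]: "head_seq y \<in> carr X" by (simp add: head_seq_def)

lemma head_seq_simps [simp]: "head_seq y 0 = y" "0 < n \<Longrightarrow> head_seq y n = 0" by (simp_all add: head_seq_def)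

lemma N_zero_iff: "N y = 0 \<longleftrightarrow> y = 0"
  using norm_le_N[of y] N_le_norm[of y] by auto

text \<open>Completeness is inherited from \<open>'y\<close>, since \<open>N\<close> lies between
  the norm and twice the norm.\<close>

lemma banach_space_renormed: "banach_space X"
proof -
  have vs: "vector_space (smul X)"
    by unfold_locales (auto simp: scale_right_distrib scale_left_distrib)
  then interpret X: vector_space "smul X" .
  have "X.subspace (carr X)"
    by (rule X.subspaceI) auto
  moreover have "\<exists>l\<in>carr X. (\<lambda>n. nrm X (u n - l)) \<longlonglongrightarrow> 0"
    if cau: "\<forall>e>0. \<exists>M. \<forall>m\<ge>M. \<forall>n\<ge>M. nrm X (u m - u n) < e" for u :: "nat \<Rightarrow> nat \<Rightarrow> 'y"
  proof -
    have "Cauchy (\<lambda>n. u n 0)"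
      unfolding Cauchy_iff using cau by (simp, meson le_less_trans norm_le_N)
    then obtain l where l: "(\<lambda>n. u n 0) \<longlonglongrightarrow> l"
      using Cauchy_convergent_iff convergent_def by blast
    have "(\<lambda>n. 2 * norm (u n 0 - l)) \<longlonglongrightarrow> 2 * 0"
      by (intro tendsto_mult tendsto_const tendsto_norm_zero) (use l LIM_zero in blast)
    hence "(\<lambda>n. 2 * norm (u n 0 - l)) \<longlonglongrightarrow> 0" by simp
    moreover have "\<bar>N y\<bar> \<le> 2 * norm y" for y
      using norm_le_N[of y] N_le_norm[of y] norm_ge_zero[of y] by linarith
    ultimately have "(\<lambda>n. N (u n 0 - l)) \<longlonglongrightarrow> 0"
      by (intro Lim_null_comparison[of "\<lambda>n. N (u n 0 - l)" "\<lambda>n. 2 * norm (u n 0 - l)"]) auto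
    thus ?thesis by (intro bexI[of _ "head_seq l"]) simp_all
  qed
  moreover have "0 \<le> N y" for y using norm_le_N norm_ge_zero order_trans by blast
  ultimately show ?thesis
    unfolding banach_space_def
    by (auto simp: vs N_zero_iff N_scale N_add fun_eq_iff) (metis neq0_conv)
qed

text \<open>The vector \<open>y\<close> supplies a unit vector for \<open>N\<close>, so that the set
  under the supremum contains 0; the supremum of an empty set is unspecified.\<close>

lemma uniformly_smooth_renormed:
  assumes smooth: "smooth_norm N" and y: "(y::'y) \<noteq> 0"
  shows "uniformly_smooth X"
  unfolding uniformly_smooth_def
proof (rule tendstoI)
  fix e :: real assume e: "0 < e"
  obtain d where d: "0 < d" "\<And>x y. N x = 1 \<Longrightarrow> N y \<le> d \<Longrightarrow> N (x + y) + N (x - y) - 2 \<le> e * N y"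
    using smooth e unfolding smooth_norm_def by blast
  have "dist (smoothness_modulus X t / t) 0 < e" if t: "0 < t" "t < d" for t
  proof -
    define A where "A = {(nrm X (x + y) + nrm X (x - y) - 2) / 2 | x y.
      x \<in> carr X \<and> y \<in> carr X \<and> nrm X x = 1 \<and> nrm X y \<le> t}"
    have upper: "a \<le> e * t / 2" if aA: "a \<in> A" for a
    proof -
      obtain x y where a: "a = (nrm X (x + y) + nrm X (x - y) - 2) / 2" "nrm X x = 1" "nrm X y \<le> t"
        using aA unfolding A_def by blast
      have "N (x 0 + y 0) + N (x 0 - y 0) - 2 \<le> e * N (y 0)"
        using a t by (intro d(2)) auto
      also have "\<dots> \<le> e * t" using a e by simp
      finally show ?thesis using a by simp
    qed
    define x where "x = scaleK (of_real (1 / N y)) y"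
    have "0 < N y" using y norm_le_N[of y] zero_less_norm_iff[of y] by linarith
    hence "N x = 1" unfolding x_def N_scale by (simp add: norm_divide)
    hence "0 \<in> A"
      unfolding A_def mem_Collect_eq using t N_zero_iff[of 0]
      by (intro exI[of _ "head_seq x"] exI[of _ 0]) simp
    hence "0 \<le> Sup A" by (intro cSup_upper bdd_aboveI[of _ "e * t / 2"] upper)
    moreover have "Sup A \<le> e * t / 2" using \<open>0 \<in> A\<close> upper by (intro cSup_least) auto
    moreover have "0 < e * t" using t e by simp
    ultimately have "0 \<le> Sup A" "Sup A < e * t" by linarith+
    thus ?thesis
      using t unfolding smoothness_modulus_def A_def[symmetric] by (simp add: pos_divide_less_eq)
  qed
  thus "\<forall>\<^sub>F t in at_right 0. dist (smoothness_modulus X t / t) 0 < e"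
    unfolding eventually_at_right_field using d(1) by auto
qed

text \<open>The constant \<open>C\<close> bounds the set under the supremum, which makes the
  supremum an upper bound.\<close>

lemma operator_norm_upper:
  assumes "u \<in> carr X" "N (u 0) \<le> 1" and "\<And>u. u \<in> carr X \<Longrightarrow> norm (T u) \<le> C * N (u 0)"
  shows "norm (T u) \<le> operator_norm X (type_space scaleK) T"
proof -
  have "norm (T w) \<le> \<bar>C\<bar>" if "w \<in> carr X" "N (w 0) \<le> 1" for w
  proof -
    have "C * N (w 0) \<le> \<bar>C\<bar> * N (w 0)"
      using norm_le_N[of "w 0"] norm_ge_zero[of "w 0"] by (intro mult_right_mono) linarith+
    also have "\<dots> \<le> \<bar>C\<bar> * 1" using that by (intro mult_left_mono) auto
    finally show ?thesis using assms(3)[OF that(1)] by simp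
  qed
  thus ?thesis
    unfolding operator_norm_def type_space_def nspace.simps renormed_simps(3)
    using assms(1,2) by (intro cSup_upper) (auto intro!: bdd_aboveI[of _ "\<bar>C\<bar>"])
qed

text \<open>
  An operator into a strictly convex space that attains its norm at \<open>x\<close> vanishes in the directions
  in which the unit sphere is flat at \<open>x\<close>, so it cannot be close to the formal identity.
\<close>

lemma not_pointwise_BPB_renormed:
  assumes strict: "\<And>x v::'y. norm (x + v) \<le> 1 \<Longrightarrow> norm (x - v) \<le> 1 \<Longrightarrow> norm x = 1 \<Longrightarrow> v = 0"
    and flat: "\<And>\<alpha>. \<alpha> < 1 \<Longrightarrow> \<exists>x v t. N x = 1 \<and> \<alpha> < norm x \<and> norm v = 1 \<and> 0 < t \<and>
      N (x + t *\<^sub>R v) \<le> 1 \<and> N (x - t *\<^sub>R v) \<le> 1"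
  shows "\<not> pointwise_BPB X (type_space scaleK)"
proof
  let ?Y = "type_space scaleK"
  \<comment> \<open>The formal identity: elements of the domain are determined by coordinate
    0.\<close>
  let ?T = "\<lambda>u::nat \<Rightarrow> 'y. u 0"
  assume "pointwise_BPB X ?Y"
  hence "\<exists>\<eta>>0. \<forall>T\<in>bounded_operators X ?Y. \<forall>x0\<in>carr X.
      operator_norm X ?Y T = 1 \<and> nrm X x0 = 1 \<and> nrm ?Y (T x0) > 1 - \<eta> \<longrightarrow>
      (\<exists>S\<in>bounded_operators X ?Y. operator_norm X ?Y S = 1 \<and> nrm ?Y (S x0) = 1 \<and>
        operator_norm X ?Y (\<lambda>x. S x - T x) < 1 / 2)"
    unfolding pointwise_BPB_def by (elim allE[of _ "1 / 2"] impE) simp_all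
  then obtain \<eta> where \<eta>: "0 < \<eta>" "\<forall>T\<in>bounded_operators X ?Y. \<forall>x0\<in>carr X.
      operator_norm X ?Y T = 1 \<and> nrm X x0 = 1 \<and> nrm ?Y (T x0) > 1 - \<eta> \<longrightarrow>
      (\<exists>S\<in>bounded_operators X ?Y. operator_norm X ?Y S = 1 \<and> nrm ?Y (S x0) = 1 \<and>
        operator_norm X ?Y (\<lambda>x. S x - T x) < 1 / 2)"
    by (elim exE conjE)
  have T: "?T \<in> bounded_operators X ?Y"
    unfolding bounded_operators_def type_space_def
    by (auto intro!: exI[of _ 1] norm_le_N)
  have "operator_norm X ?Y ?T = 1"
  proof (rule antisym)
    show "operator_norm X ?Y ?T \<le> 1"
      unfolding operator_norm_def type_space_def nspace.simps renormed_simps(3)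
    proof (rule cSup_least)
      show "{norm (x 0) |x. x \<in> carr X \<and> N (x 0) \<le> 1} \<noteq> {}"
        using N_zero_iff[of 0] by (auto intro!: exI[of _ 0])
    qed (use norm_le_N order_trans in blast)
    \<comment> \<open>The norm reaches 1 because flat points, of \<open>N\<close>-norm 1, have
      original norm arbitrarily close to 1.\<close>
    show "1 \<le> operator_norm X ?Y ?T"
    proof (rule ccontr)
      assume "\<not> ?thesis"
      then obtain x where "N x = 1" "operator_norm X ?Y ?T < norm x"
        using flat[of "operator_norm X ?Y ?T"] by (auto simp: not_le)
      thus False using operator_norm_upper[of "head_seq x" ?T 1] norm_le_N by fastforce
    qed
  qed
  moreover obtain x v t where x: "N x = 1" "1 - \<eta> < norm x" "norm v = 1" "0 < t"
    "N (x + t *\<^sub>R v) \<le> 1" "N (x - t *\<^sub>R v) \<le> 1"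
    using flat[of "1 - \<eta>"] \<eta>(1) by auto
  ultimately obtain S where S: "S \<in> bounded_operators X ?Y" "operator_norm X ?Y S = 1"
      "norm (S (head_seq x)) = 1" "operator_norm X ?Y (\<lambda>u. S u - u 0) < 1 / 2"
    using \<eta>(2)[rule_format, OF T head_seq_in_carr, of x] by (auto simp: type_space_def)
  obtain C where C: "\<And>u. u \<in> carr X \<Longrightarrow> norm (S u) \<le> C * N (u 0)"
    using S(1) unfolding bounded_operators_def type_space_def nspace.simps renormed_simps(3) by blast
  have S_add: "S (head_seq (y + z)) = S (head_seq y) + S (head_seq z)" for y z
  proof -
    have "head_seq (y + z) = head_seq y + head_seq z" by (auto simp: head_seq_def)
    thus ?thesis using S(1) head_seq_in_carr unfolding bounded_operators_def by auto
  qed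
  have S_scale: "S (head_seq (r *\<^sub>R y)) = r *\<^sub>R S (head_seq y)" for r y
  proof -
    have "head_seq (r *\<^sub>R y) = smul X (of_real r) (head_seq y)"
      by (auto simp: head_seq_def scale_of_real)
    moreover have "S (smul X c u) = scaleK c (S u)" if "u \<in> carr X" for c u
      using S(1) that unfolding bounded_operators_def type_space_def by simp
    ultimately have "S (head_seq (r *\<^sub>R y)) = scaleK (of_real r) (S (head_seq y))"
      by (simp only: head_seq_in_carr)
    thus ?thesis by (simp add: scale_of_real)
  qed
  have S_le: "norm (S (head_seq y)) \<le> 1" if "N y \<le> 1" for y
    using operator_norm_upper[of "head_seq y" S C] C that S(2) by simp
  have "t *\<^sub>R S (head_seq v) = 0"
  proof (rule strict[OF _ _ S(3)])
    show "norm (S (head_seq x) + t *\<^sub>R S (head_seq v)) \<le> 1"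
      using S_le[OF x(5)] by (simp add: S_add S_scale)
    show "norm (S (head_seq x) - t *\<^sub>R S (head_seq v)) \<le> 1"
      using S_le[of "x + (- t) *\<^sub>R v"] x(6) by (simp add: S_add S_scale del: scaleR_minus_left) simp
  qed
  hence Sv: "S (head_seq v) = 0" using x by simp
  \<comment> \<open>Half of \<open>v\<close> lies in the unit ball of \<open>N\<close>, as
    \<open>N\<close> is at most twice the norm. There \<open>S\<close> vanishes, so its distance to
    the identity is at least 1/2.\<close>
  have "norm (S (head_seq ((1 / 2) *\<^sub>R v)) - (1 / 2) *\<^sub>R v) \<le> operator_norm X ?Y (\<lambda>u. S u - u 0)"
  proof -
    have "norm (S u - u 0) \<le> (C + 1) * N (u 0)" if "u \<in> carr X" for u
      using C[OF that] norm_le_N[of "u 0"] norm_triangle_ineq4[of "S u" "u 0"]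
      by (simp add: distrib_right)
    from operator_norm_upper[where T = "\<lambda>u. S u - u 0", OF head_seq_in_carr _ this, of "(1 / 2) *\<^sub>R v"]
    show ?thesis using N_le_norm[of "(1 / 2) *\<^sub>R v"] x(3) by simp
  qed
  thus False using S(4) Sv x(3) by (simp add: S_scale)
qed

end

section \<open>Unfolding the hypotheses on the range space\<close>

text \<open>Evaluating the modulus at \<open>t = norm y\<close> turns its bound by
  \<open>e / 2 * t\<close> into one proportional to \<open>norm y\<close>.\<close>

lemma smooth_norm_type_space:
  fixes scaleK :: "'k \<Rightarrow> 'y::banach \<Rightarrow> 'y"
  assumes "uniformly_smooth (type_space scaleK)"
  shows "smooth_norm (norm :: 'y \<Rightarrow> real)"
  unfolding smooth_norm_def
proof (intro allI impI)
  fix e :: real assume "0 < e"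
  let ?\<rho> = "smoothness_modulus (type_space scaleK)"
  have "\<forall>\<^sub>F t in at_right 0. dist (?\<rho> t / t) 0 < e / 2"
    using assms \<open>0 < e\<close> unfolding uniformly_smooth_def by (intro tendstoD) simp_all
  then obtain d where d: "0 < d" "\<And>t. 0 < t \<Longrightarrow> t < d \<Longrightarrow> dist (?\<rho> t / t) 0 < e / 2"
    unfolding eventually_at_right_field by auto
  have "norm (x + y) + norm (x - y) - 2 \<le> e * norm y" if x: "norm x = 1" and y: "norm y \<le> d / 2" for x y :: 'y
  proof (cases "y = 0")
    case False
    define t where "t = norm y"
    have t: "0 < t" "t < d" using False y d(1) by (auto simp: t_def)
    define A where "A = {(norm (x + y) + norm (x - y) - 2) / 2 | x y :: 'y. norm x = 1 \<and> norm y \<le> t}"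
    have A: "?\<rho> t = Sup A" by (simp add: smoothness_modulus_def type_space_def A_def)
    have "a \<le> t" if a: "a \<in> A" for a
    proof -
      obtain x y :: 'y where "a = (norm (x + y) + norm (x - y) - 2) / 2" "norm x = 1" "norm y \<le> t"
        using a unfolding A_def by blast
      thus ?thesis using norm_triangle_ineq[of x y] norm_triangle_ineq4[of x y] by simp
    qed
    hence "(norm (x + y) + norm (x - y) - 2) / 2 \<le> Sup A"
      using x by (intro cSup_upper bdd_aboveI[of _ t]) (auto simp: A_def t_def)
    moreover have "?\<rho> t / t < e / 2" using d(2)[OF t] unfolding dist_real_def by linarith
    hence "?\<rho> t < e / 2 * t" using t by (simp add: pos_divide_less_eq)
    ultimately show ?thesis unfolding A by (simp add: t_def)
  qed (use x in simp)
  thus "\<exists>d>0. \<forall>x y::'y. norm x = 1 \<longrightarrow> norm y \<le> d \<longrightarrow> norm (x + y) + norm (x - y) - 2 \<le> e * norm y"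
    using d(1) by (intro exI[of _ "d / 2"]) auto
qed

lemma uniformly_convex_type_spaceD:
  fixes scaleK :: "'k::real_or_complex \<Rightarrow> 'y::banach \<Rightarrow> 'y"
  assumes "normed_space_over scaleK" and convex: "uniformly_convex (type_space scaleK)" and "0 < d"
  shows "\<exists>c>0. \<forall>x y::'y. norm x \<le> 1 \<longrightarrow> norm y \<le> 1 \<longrightarrow> d \<le> norm (x - y) \<longrightarrow> norm (x + y) \<le> 2 - c"
proof -
  interpret normed_space_over scaleK by fact
  \<comment> \<open>The modulus is known to be positive only up to 2, hence
    \<open>min d 2\<close>.\<close>
  define A where "A = {1 - norm (scaleK (1 / 2) (x + y)) | x y :: 'y.
    norm x \<le> 1 \<and> norm y \<le> 1 \<and> min d 2 \<le> norm (x - y)}"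
  have "convexity_modulus (type_space scaleK) (min d 2) = Inf A"
    by (simp add: convexity_modulus_def type_space_def A_def)
  moreover have "0 < convexity_modulus (type_space scaleK) (min d 2)"
    using convex \<open>0 < d\<close> unfolding uniformly_convex_def by simp
  ultimately have pos: "0 < Inf A" by simp
  have half: "norm (scaleK (1 / 2) z) = norm z / 2" for z by (simp add: norm_scale norm_divide)
  have "0 \<le> a" if a: "a \<in> A" for a
  proof -
    obtain x y :: 'y where "a = 1 - norm (scaleK (1 / 2) (x + y))" "norm x \<le> 1" "norm y \<le> 1"
      using a unfolding A_def by blast
    thus ?thesis using norm_triangle_ineq[of x y] by (simp add: half)
  qed
  hence le: "Inf A \<le> a" if "a \<in> A" for a using that by (intro cInf_lower bdd_belowI[of _ 0])
  have "norm (x + y) \<le> 2 - 2 * Inf A" if "norm x \<le> 1" "norm y \<le> 1" "d \<le> norm (x - y)" for x y :: 'y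
  proof -
    have "1 - norm (scaleK (1 / 2) (x + y)) \<in> A" unfolding A_def mem_Collect_eq using that
      by (intro exI[of _ x] exI[of _ y]) simp
    from le[OF this] show ?thesis by (simp add: half)
  qed
  thus ?thesis using pos by (intro exI[of _ "2 * Inf A"]) auto
qed

text \<open>If a single line were the whole space, any two distinct members of a basis would be
  proportional.\<close>

lemma dim_greater_one_type_spaceD:
  fixes scaleK :: "'k::real_or_complex \<Rightarrow> 'y::banach \<Rightarrow> 'y"
  assumes "normed_space_over scaleK" and "dim_greater_one (type_space scaleK)"
  shows "\<exists>w. \<forall>c. w \<noteq> scaleK c y"
proof (rule ccontr)
  assume "\<not> ?thesis"
  hence line: "\<exists>c. w = scaleK c y" for w by blast
  interpret normed_space_over scaleK by fact
  obtain B where B: "\<not> dependent B" "infinite B \<or> 1 < card B"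
    using assms(2) unfolding dim_greater_one_def by (auto simp: type_space_def)
  have "\<not> card B \<le> Suc 0 \<or> infinite B" using B(2) by auto
  then obtain b1 b2 where b: "b1 \<in> B" "b2 \<in> B" "b1 \<noteq> b2"
    by (metis card_le_Suc0_iff_eq infinite_imp_nonempty finite.emptyI finite_insert insertI1 is_singletonI'
        is_singleton_def)
  have "b1 \<noteq> 0" using B(1) b(1) dependent_zero by blast
  obtain c1 c2 where c: "b1 = scaleK c1 y" "b2 = scaleK c2 y" using line by meson
  have "c1 \<noteq> 0" using c(1) \<open>b1 \<noteq> 0\<close> by auto
  hence "b2 = scaleK (c2 / c1) b1" by (simp add: c)
  moreover have "b1 \<in> span (B - {b2})" using b by (intro span_base) auto
  ultimately have "b2 \<in> span (B - {b2})" by (metis span_scale)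
  thus False using B(1) b(2) unfolding dependent_def by blast
qed

section \<open>Choice of the gauge and of the flat points\<close>

theorem theorem4p4:
  fixes scaleK :: "'k::real_or_complex \<Rightarrow> 'y::banach \<Rightarrow> 'y"
  assumes "banach_space (type_space scaleK)"
    and "uniformly_convex (type_space scaleK)"
    and "uniformly_smooth (type_space scaleK)"
    and "dim_greater_one (type_space scaleK)"
  shows "\<not> universal_pointwise_BPB_range TYPE(nat \<Rightarrow> 'y) (type_space scaleK)"
proof -
  interpret normed_space_over scaleK
    using assms(1) unfolding banach_space_def type_space_def
    by (simp add: normed_space_over_def normed_space_over_axioms_def)
  have smooth: "smooth_norm (norm :: 'y \<Rightarrow> real)"
    using assms(3) by (rule smooth_norm_type_space)
  have convex: "\<exists>c>0. \<forall>x y::'y. norm x \<le> 1 \<longrightarrow> norm y \<le> 1 \<longrightarrow> d \<le> norm (x - y) \<longrightarrow> norm (x + y) \<le> 2 - c"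
    if d: "0 < d" for d
    using uniformly_convex_type_spaceD[OF normed_space_over_axioms assms(2) d] .
  have dim: "\<exists>w. \<forall>c. w \<noteq> scaleK c y" for y
    using dim_greater_one_type_spaceD[OF normed_space_over_axioms assms(4)] .
  obtain y f \<gamma> where y: "\<And>j. norm (y j) = 1" and f: "\<And>j. functional (f j)" "\<And>j. f j (y j) = 1"
    and \<gamma>: "\<And>j. 0 < \<gamma> j" and sep: "\<And>j k. k \<noteq> j \<Longrightarrow> norm (f j (y k)) \<le> 1 - \<gamma> j"
      "\<And>j k. k \<noteq> (j::nat) \<Longrightarrow> norm (f j (y k)) \<le> 1 - \<gamma> k"
    using exists_separated_functionals[OF smooth convex dim] by metis
  obtain v where v: "\<And>j. norm (v j) = 1" "\<And>j. f j (v j) = 0"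
    using kernel_vector[OF f dim] by metis
  \<comment> \<open>One half of \<open>\<gamma>\<close> pays for lowering 1 to
    \<open>\<alpha>\<close>, the other for moving along \<open>v\<close>. The bound
    \<open>1 / real (j + 2)\<close> makes \<open>\<alpha>\<close> tend to 1 and, being at most 1/2,
    keeps it positive.\<close>
  define \<beta> where "\<beta> j = min (\<gamma> j / 2) (1 / real (j + 2))" for j
  define \<alpha> where "\<alpha> j = 1 - \<beta> j" for j
  have \<beta>: "0 < \<beta> j" "\<beta> j \<le> \<gamma> j / 2" "\<beta> j \<le> 1 / real (j + 2)" for j
    using \<gamma>[of j] by (auto simp: \<beta>_def)
  have "1 / real (j + 2) < 1" for j by simp
  hence \<alpha>: "0 < \<alpha> j" "\<alpha> j \<le> 1" for j
    using \<beta>(1)[of j] \<beta>(3)[of j] unfolding \<alpha>_def by (smt (verit))+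
  \<comment> \<open>Epigraph of the maximum of the norm and all
    \<open>norm (f j a) / \<alpha> j\<close>, written without a supremum.\<close>
  define Q where "Q a l \<longleftrightarrow> norm a \<le> l \<and> (\<forall>j. norm (f j a) \<le> \<alpha> j * l)" for a l
  interpret gauge_epigraph scaleK Q
  proof
    show "Q 0 0" by (simp add: Q_def functionalD[OF f(1)])
    show "Q (a + b) (l + m)" if "Q a l" "Q b m" for a b l m
      unfolding Q_def
    proof (intro conjI allI)
      show "norm (a + b) \<le> l + m" using that unfolding Q_def by (meson norm_triangle_le add_mono)
      show "norm (f j (a + b)) \<le> \<alpha> j * (l + m)" for j
        using that norm_triangle_ineq[of "f j a" "f j b"]
        unfolding Q_def functionalD(1)[OF f(1)] distrib_left by (meson add_mono order_trans)
    qed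
    show "Q (scaleK c a) (norm c * l)" if "Q a l" for a c l
      using that unfolding Q_def
      by (auto simp: norm_scale functionalD[OF f(1)] norm_mult mult.left_commute[of "\<alpha> _"] intro!: mult_left_mono)
    show "norm a \<le> l" if "Q a l" for a l using that by (simp add: Q_def)
  qed
  \<comment> \<open>The constraint of \<open>f k\<close> is tight at \<open>y k\<close> and constant
    along \<open>v k\<close>, which lies in its kernel. The other constraints have slack enough for
    \<open>\<bar>t\<bar> \<le> \<beta> k\<close>.\<close>
  have segment: "Q (y k + t *\<^sub>R v k) (1 / \<alpha> k)" if t: "\<bar>t\<bar> \<le> \<beta> k" for k t
    unfolding Q_def
  proof (intro conjI allI)
    have "(1 + \<beta> k) * \<alpha> k \<le> 1" by (simp add: \<alpha>_def algebra_simps)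
    hence "1 + \<beta> k \<le> 1 / \<alpha> k" using \<alpha>(1)[of k] by (simp add: pos_le_divide_eq)
    thus "norm (y k + t *\<^sub>R v k) \<le> 1 / \<alpha> k"
      using norm_triangle_ineq[of "y k" "t *\<^sub>R v k"] t by (simp add: y v)
    fix j
    show "norm (f j (y k + t *\<^sub>R v k)) \<le> \<alpha> j * (1 / \<alpha> k)"
    proof (cases "j = k")
      case True
      thus ?thesis using \<alpha>(1)[of k] by (simp add: functionalD[OF f(1)] f v)
    next
      case False
      have "norm (f j (y k + t *\<^sub>R v k)) \<le> norm (f j (y k)) + \<bar>t\<bar> * norm (f j (v k))"
        using norm_triangle_ineq[of "f j (y k)" "of_real t * f j (v k)"]
        by (simp add: functionalD[OF f(1)] norm_mult)
      also have "\<dots> \<le> norm (f j (y k)) + \<bar>t\<bar> * 1"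
        using functionalD(3)[OF f(1), of j "v k"] v(1) by (intro add_left_mono mult_left_mono) auto
      \<comment> \<open>The average of the two separation bounds is
        \<open>1 - (\<gamma> j + \<gamma> k) / 2\<close>, at most
        \<open>1 - \<beta> j - \<beta> k\<close>.\<close>
      also have "\<dots> \<le> \<alpha> j"
        using sep[of k j] False \<beta>(2)[of j] \<beta>(2)[of k] t unfolding \<alpha>_def by linarith
      also have "\<dots> \<le> \<alpha> j * (1 / \<alpha> k)"
        using \<alpha>[of k] \<alpha>(1)[of j] by (simp add: pos_le_divide_eq)
      finally show ?thesis .
    qed
  qed
  interpret equivalent_norm scaleK envelope
    by unfold_locales (rule envelope_add envelope_scale norm_le_envelope envelope_le_norm)+
  have "\<not> pointwise_BPB X (type_space scaleK)"
  proof (rule not_pointwise_BPB_renormed)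
    fix x v :: 'y assume xv: "norm (x + v) \<le> 1" "norm (x - v) \<le> 1" "norm x = 1"
    show "v = 0"
    proof (rule ccontr)
      assume "v \<noteq> 0"
      \<comment> \<open>Uniform convexity is applied to \<open>x + v\<close> and
        \<open>x - v\<close>, which are \<open>2 * norm v\<close> apart while their sum has norm
        2.\<close>
      then obtain c where "c > 0" "\<And>x y::'y. norm x \<le> 1 \<Longrightarrow> norm y \<le> 1 \<Longrightarrow>
          norm (2 *\<^sub>R v) \<le> norm (x - y) \<Longrightarrow> norm (x + y) \<le> 2 - c"
        using convex[of "norm (2 *\<^sub>R v)"] by auto
      from this(1) this(2)[OF xv(1,2)] show False
        using xv(3) by (simp flip: scaleR_2)
    qed
  next
    fix a :: real assume "a < 1"
    then obtain k where "inverse (real (Suc k)) < 1 - a"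
      using reals_Archimedean[of "1 - a"] by auto
    moreover have "1 / real (k + 2) \<le> inverse (real (Suc k))" by (simp add: field_simps)
    ultimately have k: "a < \<alpha> k" using \<beta>(3)[of k] by (simp add: \<alpha>_def)
    have Qf: "norm (f k b) \<le> \<alpha> k * l" if "Q b l" for b l using that by (simp add: Q_def)
    \<comment> \<open>Division by \<open>n\<close> puts \<open>y k\<close> on the unit sphere of the
      envelope, and \<open>\<alpha> k * n \<le> 1\<close> leaves it a norm of at least
      \<open>\<alpha> k\<close>.\<close>
    define n where "n = envelope (y k)"
    have n: "1 \<le> n" using norm_le_envelope[of "y k"] y by (simp add: n_def)
    have "\<alpha> k * n \<le> 1"
      unfolding n_def by (rule envelope_flat(1)[OF f y \<alpha> Qf segment \<beta>(1)])
    obtain t where t: "0 < t" "envelope (y k + t *\<^sub>R v k) \<le> n" "envelope (y k - t *\<^sub>R v k) \<le> n"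
      unfolding n_def using envelope_flat(2)[OF f y \<alpha> Qf segment \<beta>(1)] by blast
    have scaleR: "envelope ((1 / n) *\<^sub>R z) = envelope z / n" for z
      using envelope_scale[of "of_real (1 / n)" z, unfolded scale_of_real] n by (simp add: norm_divide)
    have "envelope ((1 / n) *\<^sub>R y k) = 1" using n by (simp add: scaleR flip: n_def)
    moreover have "a < norm ((1 / n) *\<^sub>R y k)"
      using k \<open>\<alpha> k * n \<le> 1\<close> n y by (simp add: less_le_trans pos_le_divide_eq)
    moreover have "envelope ((1 / n) *\<^sub>R y k + (t / n) *\<^sub>R v k) \<le> 1"
      using scaleR[of "y k + t *\<^sub>R v k"] t n by (simp add: scaleR_right_distrib)
    moreover have "envelope ((1 / n) *\<^sub>R y k - (t / n) *\<^sub>R v k) \<le> 1"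
      using scaleR[of "y k - t *\<^sub>R v k"] t n by (simp add: scaleR_right_diff_distrib)
    moreover have "0 < t / n" using t n by simp
    ultimately show "\<exists>x v t. envelope x = 1 \<and> a < norm x \<and> norm v = 1 \<and> 0 < t \<and>
        envelope (x + t *\<^sub>R v) \<le> 1 \<and> envelope (x - t *\<^sub>R v) \<le> 1"
      using v(1) by blast
  qed
  moreover have "y 0 \<noteq> 0" using y[of 0] by auto
  ultimately show ?thesis
    unfolding universal_pointwise_BPB_range_def
    using banach_space_renormed uniformly_smooth_renormed[OF smooth_envelope[OF smooth]] by blast
qed

end
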